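(* For any $n\in\mathbb N$, the lattice of all subvarieties of the monoid variety $\mathbf P_n=\operatorname{var}\{x^n\approx x^{n+1},\ x^ny\approx yx^n,\ x^2y\approx xyx\}$ is distributive.
   Context: Monoids are considered as semigroups with an additional 0-ary operation fixing the identity element; varieties are varieties of such algebras; $\operatorname{var}\Sigma$ is the monoid variety given by the identity system $\Sigma$; $\mathbb N=\{1,2,\dots\}$. *)

theory Defs
  imports "HOL-Algebra.Group" "HOL-Library.Countable_Set"
begin

text \<open>Identities are pairs of words over the countable alphabet of variables \<^typ>\<open>nat\<close>;
  the empty word stands for the identity element.\<close>

type_synonym monoid_word = "nat list"
type_synonym monoid_identity = "monoid_word \<times> monoid_word"

definition word_value :: "('a, 'b) monoid_scheme \<Rightarrow> (nat \<Rightarrow> 'a) \<Rightarrow> monoid_word \<Rightarrow> 'a" where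
  "word_value M \<phi> w = foldr (\<lambda>x a. \<phi> x \<otimes>\<^bsub>M\<^esub> a) w \<one>\<^bsub>M\<^esub>"

definition satisfies_identity :: "('a, 'b) monoid_scheme \<Rightarrow> monoid_identity \<Rightarrow> bool" where
  "satisfies_identity M e \<longleftrightarrow>
     (\<forall>\<phi> \<in> UNIV \<rightarrow> carrier M. word_value M \<phi> (fst e) = word_value M \<phi> (snd e))"

text \<open>The members of a class of monoids have their carriers inside the type \<^typ>\<open>'a\<close>.
  When \<^typ>\<open>'a\<close> is infinite this does not affect which varieties exist or how they are
  ordered: see \<open>var_subset_transfer\<close> below.\<close>

definition monoid_var :: "monoid_identity set \<Rightarrow> 'a monoid set" where
  "monoid_var \<Sigma> = {M. monoid M \<and> (\<forall>e\<in>\<Sigma>. satisfies_identity M e)}"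

definition monoid_variety :: "'a monoid set \<Rightarrow> bool" where
  "monoid_variety V \<longleftrightarrow> (\<exists>\<Sigma>. V = monoid_var \<Sigma>)"

definition subvariety_lattice :: "'a monoid set \<Rightarrow> 'a monoid set gorder" where
  "subvariety_lattice V =
     \<lparr>carrier = {W. monoid_variety W \<and> W \<subseteq> V}, eq = (=), le = (\<subseteq>)\<rparr>"

locale distributive_lattice = lattice +
  assumes meet_join_distrib:
    "\<lbrakk>x \<in> carrier L; y \<in> carrier L; z \<in> carrier L\<rbrakk>
      \<Longrightarrow> x \<sqinter> (y \<squnion> z) = (x \<sqinter> y) \<squnion> (x \<sqinter> z)"

text \<open>The variables $x$ and $y$ are the letters \<open>0\<close> and \<open>1\<close>.\<close>

definition P_identities :: "nat \<Rightarrow> monoid_identity set" where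
  "P_identities n =
     {(replicate n 0, replicate (n + 1) 0),
      (replicate n 0 @ [1], [1] @ replicate n 0),
      ([0, 0, 1], [0, 1, 0])}"

definition P_variety :: "nat \<Rightarrow> 'a monoid set" where
  "P_variety n = monoid_var (P_identities n)"

lemma word_value_Nil: "word_value M \<phi> [] = \<one>\<^bsub>M\<^esub>"
  and word_value_Cons: "word_value M \<phi> (x # w) = \<phi> x \<otimes>\<^bsub>M\<^esub> word_value M \<phi> w"
  by (simp_all add: word_value_def)

lemma word_value_closed:
  assumes "monoid M" "\<phi> \<in> UNIV \<rightarrow> carrier M"
  shows "word_value M \<phi> w \<in> carrier M"
proof -
  interpret monoid M by fact
  show ?thesis
    using assms(2) by (induction w) (auto simp: word_value_Nil word_value_Cons)
qed

lemma word_value_append: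
  assumes "monoid M" "\<phi> \<in> UNIV \<rightarrow> carrier M"
  shows "word_value M \<phi> (u @ v) = word_value M \<phi> u \<otimes>\<^bsub>M\<^esub> word_value M \<phi> v"
proof -
  interpret monoid M by fact
  show ?thesis
    using assms word_value_closed[OF assms]
    by (induction u) (auto simp: word_value_Nil word_value_Cons m_assoc Pi_iff)
qed

text \<open>Inclusion between varieties over an infinite universe \<^typ>\<open>'a\<close> implies the same
  inclusion over every other universe \<^typ>\<open>'b\<close>: an identity that fails in a monoid already
  fails in a countable submonoid, which has a copy inside \<^typ>\<open>'a\<close>.\<close>

lemma var_subset_transfer:
  assumes inf: "infinite (UNIV :: 'a set)"
    and sub: "(monoid_var \<Sigma> :: 'a monoid set) \<subseteq> monoid_var \<Sigma>'"
  shows "(monoid_var \<Sigma> :: 'b monoid set) \<subseteq> monoid_var \<Sigma>'"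
proof
  fix M :: "'b monoid"
  assume M: "M \<in> monoid_var \<Sigma>"
  then have mon: "monoid M" and sat: "\<And>e. e \<in> \<Sigma> \<Longrightarrow> satisfies_identity M e"
    by (auto simp: monoid_var_def)
  interpret monoid M by fact
  have "satisfies_identity M e" if e: "e \<in> \<Sigma>'" for e
    unfolding satisfies_identity_def
  proof
    fix \<phi> :: "nat \<Rightarrow> 'b" assume \<phi>: "\<phi> \<in> UNIV \<rightarrow> carrier M"
    define S where "S = range (word_value M \<phi>)"
    have Scarr: "S \<subseteq> carrier M"
      using word_value_closed[OF mon \<phi>] by (auto simp: S_def)
    have Smult: "a \<otimes>\<^bsub>M\<^esub> b \<in> S" if "a \<in> S" "b \<in> S" for a b
      using that by (auto simp: S_def word_value_append[OF mon \<phi>, symmetric])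
    have Sone: "\<one>\<^bsub>M\<^esub> \<in> S"
      unfolding S_def by (rule range_eqI[where x = "[]"]) (simp add: word_value_Nil)
    have \<phi>S: "\<phi> x \<in> S" for x
    proof -
      have "word_value M \<phi> [x] = \<phi> x"
        using \<phi> by (simp add: word_value_Nil word_value_Cons Pi_iff)
      then show ?thesis unfolding S_def by (intro range_eqI[where x = "[x]"]) simp
    qed
    obtain g :: "nat \<Rightarrow> 'a" where g: "inj g"
      using inf infinite_countable_subset by blast
    define h where "h = g \<circ> to_nat_on S"
    have h: "inj_on h S"
    proof -
      have "countable S" by (simp add: S_def)
      then show ?thesis
        unfolding h_def using g by (meson comp_inj_on inj_on_subset inj_on_to_nat_on top_greatest)
    qed
    define k where "k = the_inv_into S h"
    have kh: "k (h a) = a" if "a \<in> S" for a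
      using h that by (simp add: k_def the_inv_into_f_f)
    define N :: "'a monoid" where
      "N = \<lparr>carrier = h ` S, mult = (\<lambda>a b. h (k a \<otimes>\<^bsub>M\<^esub> k b)), one = h \<one>\<^bsub>M\<^esub>\<rparr>"
    have monN: "monoid N"
      using Scarr Smult Sone
      by (intro monoidI) (auto simp: N_def kh m_assoc subset_iff)
    have val: "word_value N \<psi> w = h (word_value M (k \<circ> \<psi>) w) \<and> word_value M (k \<circ> \<psi>) w \<in> S"
      if \<psi>: "\<psi> \<in> UNIV \<rightarrow> carrier N" for \<psi> :: "nat \<Rightarrow> 'a" and w
    proof (induction w)
      case Nil
      then show ?case using Sone by (simp add: word_value_Nil N_def)
    next
      case (Cons x w)
      have "\<psi> x \<in> h ` S" using \<psi> by (auto simp: N_def)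
      then show ?case
        using Cons Smult by (auto simp: word_value_Cons N_def kh)
    qed
    have "satisfies_identity N d" if "d \<in> \<Sigma>" for d
      unfolding satisfies_identity_def
    proof
      fix \<psi> :: "nat \<Rightarrow> 'a" assume \<psi>: "\<psi> \<in> UNIV \<rightarrow> carrier N"
      have "k (\<psi> x) \<in> carrier M" for x
      proof -
        have "\<psi> x \<in> h ` S" using \<psi> by (auto simp: N_def)
        then show ?thesis using kh Scarr by auto
      qed
      then have "k \<circ> \<psi> \<in> UNIV \<rightarrow> carrier M" by auto
      then show "word_value N \<psi> (fst d) = word_value N \<psi> (snd d)"
        using sat[OF that] val[OF \<psi>] by (simp add: satisfies_identity_def)
    qed
    then have "N \<in> monoid_var \<Sigma>'"
      using monN sub by (auto simp: monoid_var_def)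
    then have Ne: "satisfies_identity N e"
      using e by (auto simp: monoid_var_def)
    have h\<phi>: "h \<circ> \<phi> \<in> UNIV \<rightarrow> carrier N"
      using \<phi>S by (auto simp: N_def)
    have "k \<circ> (h \<circ> \<phi>) = \<phi>"
      using \<phi>S kh by auto
    then show "word_value M \<phi> (fst e) = word_value M \<phi> (snd e)"
      using Ne h\<phi> val[OF h\<phi>] h unfolding satisfies_identity_def by (metis inj_onD)
  qed
  then show "M \<in> monoid_var \<Sigma>'"
    using mon by (simp add: monoid_var_def)
qed

end

theory Submission
  imports Defs
begin

text \<open>Modulo $x^2y \approx xyx$ all occurrences of a letter can be moved next to its first one, so a
  word is determined by the numbers of occurrences of its letters and by the order of their first
  occurrences. Hence every identity is equivalent within $\mathbf P_n$ to a set of basic identities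
  $x^k \approx x^{k+1}$ and $x^k y^l \approx y^l x^k$. Basic identities are prime: if one fails in
  both of two subvarieties, a single small monoid in their intersection refutes it. Distributivity
  follows because a basic identity then holds in an intersection iff it holds in one of the two
  varieties, and it holds in a join iff it holds in both.\<close>

section \<open>First occurrences, and letters that two words order oppositely\<close>

definition precedes :: "'a list \<Rightarrow> 'a \<Rightarrow> 'a \<Rightarrow> bool" where
  "precedes xs a b \<longleftrightarrow> (\<exists>p q. xs = p @ q \<and> a \<in> set p \<and> b \<in> set q)"

lemma precedes_appendI: "a \<in> set p \<Longrightarrow> b \<in> set q \<Longrightarrow> precedes (p @ q) a b"
  by (auto simp: precedes_def)

lemma precedes_ConsI: "b \<in> set xs \<Longrightarrow> precedes (a # xs) a b"
  using precedes_appendI[of a "[a]" b xs] by simp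

lemma precedes_Cons: "precedes xs a b \<Longrightarrow> precedes (c # xs) a b"
  unfolding precedes_def by (metis append_Cons list.set_intros(2))

lemma precedes_insert:
  assumes "precedes (p @ q) a b"
  shows "precedes (p @ c # q) a b"
proof -
  obtain s t where st: "p @ q = s @ t" "a \<in> set s" "b \<in> set t"
    using assms by (auto simp: precedes_def)
  from st(1) consider k where "s = p @ k" "q = k @ t" | k where "p = s @ k" "t = k @ q"
    by (auto simp: append_eq_append_conv2)
  then show ?thesis
  proof cases
    case 1
    then show ?thesis using st precedes_appendI[of a "p @ c # k" b t] by auto
  next
    case 2
    then show ?thesis using st precedes_appendI[of a s b "k @ c # q"] by auto
  qed
qed

text \<open>\<open>remdups\<close> would keep the last occurrence of each letter. Repeated letters
  are collected at the first one, so here the first occurrences are kept, in their order.\<close>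

primrec first_occs :: "'a list \<Rightarrow> 'a list" where
  "first_occs [] = []"
| "first_occs (x # w) = x # removeAll x (first_occs w)"

lemma set_first_occs [simp]: "set (first_occs w) = set w"
  by (induction w) auto

lemma distinct_first_occs [simp]: "distinct (first_occs w)"
  by (induction w) (auto simp: distinct_removeAll)

text \<open>Both letters occur in both words. These are the pairs that have to commute when the
  normal form of \<open>u\<close> is rearranged into that of \<open>v\<close>.\<close>

definition inverted :: "'a list \<Rightarrow> 'a list \<Rightarrow> 'a \<Rightarrow> 'a \<Rightarrow> bool" where
  "inverted u v a b \<longleftrightarrow> precedes (first_occs u) a b \<and> precedes (first_occs v) b a"

lemma inverted_count_ge:
  assumes "inverted u v a b"
  shows "1 \<le> count_list u a" "1 \<le> count_list u b"
proof -
  have "a \<in> set (first_occs u)" "b \<in> set (first_occs u)"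
    using assms by (auto simp: inverted_def precedes_def simp del: set_first_occs)
  then have "a \<in> set u" "b \<in> set u" by simp_all
  then show "1 \<le> count_list u a" "1 \<le> count_list u b"
    using count_list_0_iff[of u a] count_list_0_iff[of u b] by linarith+
qed

section \<open>Evaluation and reordering of words in arbitrary monoids\<close>

lemma word_value_cong:
  "(\<And>x. x \<in> set w \<Longrightarrow> \<phi> x = \<psi> x) \<Longrightarrow> word_value M \<phi> w = word_value M \<psi> w"
  by (induction w) (auto simp: word_value_Nil word_value_Cons)

lemma (in monoid) word_value_commute:
  assumes "\<phi> \<in> UNIV \<rightarrow> carrier G" "a \<in> carrier G"
    and "\<And>x. x \<in> set w \<Longrightarrow> a \<otimes> \<phi> x = \<phi> x \<otimes> a"
  shows "a \<otimes> word_value G \<phi> w = word_value G \<phi> w \<otimes> a"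
  using assms(3)
proof (induction w)
  case Nil
  then show ?case using assms by (simp add: word_value_Nil)
next
  case (Cons x w)
  have c: "\<phi> x \<in> carrier G" "word_value G \<phi> w \<in> carrier G"
    using assms word_value_closed[OF monoid_axioms] by auto
  have "a \<otimes> (\<phi> x \<otimes> word_value G \<phi> w) = \<phi> x \<otimes> (a \<otimes> word_value G \<phi> w)"
    using Cons.prems[of x] c assms(2) by (simp flip: m_assoc)
  also have "\<dots> = \<phi> x \<otimes> word_value G \<phi> w \<otimes> a"
    using Cons c assms(2) by (simp add: m_assoc)
  finally show ?case by (simp add: word_value_Cons)
qed

lemma (in monoid) word_value_one:
  "(\<And>x. x \<in> set w \<Longrightarrow> \<phi> x = \<one>) \<Longrightarrow> word_value G \<phi> w = \<one>"
  by (induction w) (auto simp: word_value_Nil word_value_Cons)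

text \<open>Bubble sort: the first letter of one list is moved to the front of the other one past
  letters with which it forms inverted pairs.\<close>

lemma (in monoid) word_value_reorder:
  assumes \<phi>: "\<phi> \<in> UNIV \<rightarrow> carrier G"
  shows "\<lbrakk>distinct xs; distinct ys; set xs = set ys;
      \<And>a b. precedes xs a b \<Longrightarrow> precedes ys b a \<Longrightarrow> \<phi> a \<otimes> \<phi> b = \<phi> b \<otimes> \<phi> a\<rbrakk>
    \<Longrightarrow> word_value G \<phi> xs = word_value G \<phi> ys"
proof (induction xs arbitrary: ys)
  case Nil
  then show ?case by simp
next
  case (Cons x xs)
  note closed = word_value_closed[OF monoid_axioms \<phi>]
  obtain p q where ys: "ys = p @ x # q"
    using Cons.prems(3) by (metis list.set_intros(1) split_list)
  have "set xs = set (x # xs) - {x}" using Cons.prems(1) by auto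
  also have "\<dots> = set (p @ q)" using Cons.prems(2,3) ys by auto
  finally have eq: "set xs = set (p @ q)" .
  have x: "\<phi> x \<in> carrier G" using \<phi> by auto
  \<comment> \<open>Deleting \<open>x\<close> from both lists creates no new inverted pairs, so the
    induction hypothesis applies to \<open>xs\<close> and \<open>p @ q\<close>.\<close>
  have "word_value G \<phi> xs = word_value G \<phi> (p @ q)"
  proof (rule Cons.IH)
    show "\<phi> a \<otimes> \<phi> b = \<phi> b \<otimes> \<phi> a" if "precedes xs a b" "precedes (p @ q) b a" for a b
      using that Cons.prems(4) ys by (auto intro: precedes_Cons precedes_insert)
  qed (use Cons.prems eq ys in auto)
  moreover have "\<phi> x \<otimes> word_value G \<phi> p = word_value G \<phi> p \<otimes> \<phi> x"
  proof (rule word_value_commute[OF \<phi> x])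
    fix a assume a: "a \<in> set p"
    then have "precedes ys a x" "precedes (x # xs) x a"
      using ys eq by (auto intro: precedes_appendI precedes_ConsI)
    then show "\<phi> x \<otimes> \<phi> a = \<phi> a \<otimes> \<phi> x" using Cons.prems(4) by blast
  qed
  ultimately show ?case
    using x closed ys
    by (simp add: word_value_Cons word_value_append[OF monoid_axioms \<phi>]) (simp flip: m_assoc)
qed

section \<open>The basic identities in terms of elements\<close>

definition pow_id :: "nat \<Rightarrow> monoid_identity" where
  "pow_id k = (replicate k 0, replicate (Suc k) 0)"

definition comm_id :: "nat \<Rightarrow> nat \<Rightarrow> monoid_identity" where
  "comm_id k l = (replicate k 0 @ replicate l 1, replicate l 1 @ replicate k 0)"

lemma (in monoid) word_value_replicate:
  assumes "\<phi> \<in> UNIV \<rightarrow> carrier G"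
  shows "word_value G \<phi> (replicate k x) = \<phi> x [^] k"
proof (induction k)
  case (Suc k)
  then show ?case using assms nat_pow_Suc2[of "\<phi> x" k]
    by (auto simp: word_value_Cons Pi_iff simp del: nat_pow_Suc)
qed (simp add: word_value_Nil)

lemma (in monoid) satisfies_pow_id:
  "satisfies_identity G (pow_id k) \<longleftrightarrow> (\<forall>a\<in>carrier G. a [^] k = a [^] Suc k)"
proof
  assume s: "satisfies_identity G (pow_id k)"
  show "\<forall>a\<in>carrier G. a [^] k = a [^] Suc k"
  proof
    fix a assume "a \<in> carrier G"
    then have "(\<lambda>_. a) \<in> UNIV \<rightarrow> carrier G" by auto
    then show "a [^] k = a [^] Suc k"
      using s unfolding satisfies_identity_def pow_id_def
      by (metis word_value_replicate fst_conv snd_conv)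
  qed
next
  assume "\<forall>a\<in>carrier G. a [^] k = a [^] Suc k"
  then show "satisfies_identity G (pow_id k)"
    unfolding satisfies_identity_def pow_id_def
    by (auto simp: word_value_replicate Pi_iff simp del: nat_pow_Suc replicate_Suc)
qed

lemma (in monoid) satisfies_comm_id:
  "satisfies_identity G (comm_id k l) \<longleftrightarrow>
     (\<forall>a\<in>carrier G. \<forall>b\<in>carrier G. a [^] k \<otimes> b [^] l = b [^] l \<otimes> a [^] k)"
  (is "?L \<longleftrightarrow> ?R")
proof
  assume s: ?L
  show ?R
  proof (intro ballI)
    fix a b assume "a \<in> carrier G" "b \<in> carrier G"
    then have f: "(\<lambda>i::nat. if i = 0 then a else b) \<in> UNIV \<rightarrow> carrier G" by auto
    show "a [^] k \<otimes> b [^] l = b [^] l \<otimes> a [^] k"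
      using bspec[OF s[unfolded satisfies_identity_def] f]
      by (simp add: comm_id_def word_value_append[OF monoid_axioms f] word_value_replicate[OF f])
  qed
next
  assume r: ?R
  show ?L
    unfolding satisfies_identity_def
  proof
    fix \<phi> :: "nat \<Rightarrow> 'a" assume f: "\<phi> \<in> UNIV \<rightarrow> carrier G"
    then have "\<phi> 0 \<in> carrier G" "\<phi> 1 \<in> carrier G" by auto
    then show "word_value G \<phi> (fst (comm_id k l)) = word_value G \<phi> (snd (comm_id k l))"
      using r by (simp add: comm_id_def word_value_append[OF monoid_axioms f] word_value_replicate[OF f])
  qed
qed

section \<open>Monoids of the given variety: normal form and reduction to basic identities\<close>

locale P_monoid = monoid +
  fixes n :: nat
  assumes pow_stable: "a \<in> carrier G \<Longrightarrow> a [^] n = a [^] Suc n"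
    and pow_central: "\<lbrakk>a \<in> carrier G; b \<in> carrier G\<rbrakk> \<Longrightarrow> a [^] n \<otimes> b = b \<otimes> a [^] n"
    and absorb: "\<lbrakk>a \<in> carrier G; b \<in> carrier G\<rbrakk> \<Longrightarrow> a \<otimes> b \<otimes> a = a \<otimes> a \<otimes> b"

lemma P_monoidI:
  assumes "M \<in> P_variety n"
  shows "P_monoid M n"
proof -
  have m: "monoid M" and s: "\<And>e. e \<in> P_identities n \<Longrightarrow> satisfies_identity M e"
    using assms by (auto simp: P_variety_def monoid_var_def)
  interpret monoid M by (rule m)
  show ?thesis
  proof
    fix a b assume ab: "a \<in> carrier M" "b \<in> carrier M"
    then have f: "(\<lambda>i::nat. if i = 0 then a else b) \<in> UNIV \<rightarrow> carrier M" by auto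
    have v: "word_value M (\<lambda>i. if i = 0 then a else b) u = word_value M (\<lambda>i. if i = 0 then a else b) v"
      if "(u, v) \<in> P_identities n" for u v
      using s[OF that] f by (auto simp: satisfies_identity_def)
    show "a [^]\<^bsub>M\<^esub> n \<otimes>\<^bsub>M\<^esub> b = b \<otimes>\<^bsub>M\<^esub> a [^]\<^bsub>M\<^esub> n"
      using v[of "replicate n 0 @ [1]" "[1] @ replicate n 0"] ab
      by (simp add: P_identities_def word_value_append[OF m f] word_value_replicate[OF f]
          word_value_Cons word_value_Nil)
    show "a \<otimes>\<^bsub>M\<^esub> b \<otimes>\<^bsub>M\<^esub> a = a \<otimes>\<^bsub>M\<^esub> a \<otimes>\<^bsub>M\<^esub> b"
      using v[of "[0,0,1]" "[0,1,0]"] ab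
      by (simp add: P_identities_def word_value_Cons word_value_Nil m_assoc)
  next
    fix a assume "a \<in> carrier M"
    moreover have "satisfies_identity M (pow_id n)"
      using s by (simp add: P_identities_def pow_id_def)
    ultimately show "a [^]\<^bsub>M\<^esub> n = a [^]\<^bsub>M\<^esub> Suc n"
      by (simp add: satisfies_pow_id)
  qed
qed

lemma (in monoid) pow_stable_ge:
  assumes "a \<in> carrier G" "a [^] k = a [^] Suc k" "k \<le> (j::nat)"
  shows "a [^] j = a [^] k"
  using assms(3)
proof (induction rule: dec_induct)
  case (step j)
  have "a [^] Suc j = a [^] Suc k" by (simp only: nat_pow_Suc step.IH)
  then show ?case by (simp only: assms(2)[symmetric])
qed simp

context P_monoid
begin

text \<open>Adding \<open>l - k\<close> to an exponent that is at least \<open>k\<close> leaves the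
  power unchanged. So \<open>a [^] k\<close> equals powers with arbitrarily large exponents, and
  those are already stable.\<close>

lemma eq_pow_imp_stable:
  assumes a: "a \<in> carrier G" and eq: "a [^] (k::nat) = a [^] l" and "k < l"
  shows "a [^] k = a [^] Suc k"
proof -
  define d where "d = l - k"
  have d: "d \<ge> 1" "l = k + d" using \<open>k < l\<close> by (auto simp: d_def)
  have *: "a [^] (k + j * d) = a [^] k" for j
  proof (induction j)
    case (Suc j)
    have "a [^] (k + Suc j * d) = a [^] l \<otimes> a [^] (j * d)"
      using a d by (simp add: nat_pow_mult algebra_simps)
    also have "\<dots> = a [^] (k + j * d)"
      using a by (simp add: nat_pow_mult flip: eq)
    finally show ?case using Suc by simp
  qed simp
  \<comment> \<open>Since \<open>d\<close> is at least 1, adding it \<open>n\<close> times carries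
    both \<open>k\<close> and \<open>Suc k\<close> into the range where all powers equal
    \<open>a [^] n\<close>.\<close>
  have ge: "n \<le> k + n * d" "n \<le> Suc (k + n * d)"
    using mult_le_mono2[OF d(1), of n] by linarith+
  have "a [^] k = a [^] (k + n * d)" by (rule *[symmetric])
  also have "\<dots> = a [^] n" by (rule pow_stable_ge[OF a pow_stable[OF a] ge(1)])
  also have "\<dots> = a [^] Suc (k + n * d)" by (rule pow_stable_ge[OF a pow_stable[OF a] ge(2), symmetric])
  also have "\<dots> = a [^] Suc k" by (simp only: nat_pow_Suc *)
  finally show ?thesis .
qed

text \<open>Beyond \<open>k\<close>, raising the exponent by \<open>n\<close> changes nothing; this
  identifies \<open>a [^] j\<close> with \<open>a [^] n\<close>, which is central.\<close>

lemma stable_pow_central: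
  assumes "a \<in> carrier G" "b \<in> carrier G" "a [^] k = a [^] Suc k" "k \<le> (j::nat)"
  shows "a [^] j \<otimes> b = b \<otimes> a [^] j"
proof -
  have "a [^] j = a [^] (n + j)"
    using pow_stable_ge[OF assms(1,3), of j] pow_stable_ge[OF assms(1,3), of "n + j"] assms(4)
    by (metis trans_le_add2)
  also have "\<dots> = a [^] n"
    by (rule pow_stable_ge[OF assms(1) pow_stable[OF assms(1)]]) simp
  finally show ?thesis using pow_central assms by simp
qed

text \<open>Each \<open>a\<close> behind \<open>b\<close> is pulled to the left by
  \<open>absorb\<close>. This requires an \<open>a\<close> standing before \<open>b\<close>, hence
  \<open>k\<close> is at least 1.\<close>

lemma pow_absorb:
  assumes a: "a \<in> carrier G" and b: "b \<in> carrier G" and "k \<ge> (1::nat)"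
  shows "a [^] k \<otimes> b \<otimes> a [^] j = a [^] (k + j) \<otimes> b"
proof (induction j)
  case 0
  show ?case using a b by simp
next
  case (Suc j)
  obtain m where m: "k + j = Suc m" using \<open>k \<ge> 1\<close> by (cases "k + j") auto
  have "a [^] k \<otimes> b \<otimes> a [^] Suc j = a [^] (k + j) \<otimes> b \<otimes> a"
    using a b Suc by (simp flip: m_assoc)
  \<comment> \<open>One factor is split off the power so that \<open>absorb\<close> finds
    \<open>a\<close>, \<open>b\<close>, \<open>a\<close>.\<close>
  also have "\<dots> = a [^] m \<otimes> (a \<otimes> b \<otimes> a)"
    using a b m by (simp add: m_assoc)
  also have "\<dots> = a [^] (k + Suc j) \<otimes> b"
    using a b m by (simp add: absorb[OF a b]) (simp add: m_assoc)
  finally show ?case .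
qed

text \<open>Surplus factors wait at the right end while the shorter powers are exchanged; absorption
  moves them between that end and the block of the same letter. The exponent of \<open>b\<close> is
  raised first, then that of \<open>a\<close>.\<close>

lemma comm_pow_mono:
  assumes a: "a \<in> carrier G" and b: "b \<in> carrier G"
    and ge: "1 \<le> (k::nat)" "1 \<le> (l::nat)" and le: "k \<le> k'" "l \<le> l'"
    and eq: "a [^] k \<otimes> b [^] l = b [^] l \<otimes> a [^] k"
  shows "a [^] k' \<otimes> b [^] l' = b [^] l' \<otimes> a [^] k'"
proof -
  obtain i j where [simp]: "k' = k + i" "l' = l + j" using le by (metis le_add_diff_inverse)
  have c: "a [^] k \<otimes> b [^] l' = b [^] l' \<otimes> a [^] k"
  proof -
    have "a [^] k \<otimes> b [^] l' = b [^] l \<otimes> a [^] k \<otimes> b [^] j"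
      using a b eq by (simp flip: nat_pow_mult m_assoc)
    also have "\<dots> = b [^] l' \<otimes> a [^] k" using pow_absorb a b ge by simp
    finally show ?thesis .
  qed
  have "a [^] k' \<otimes> b [^] l' = a [^] k \<otimes> b [^] l' \<otimes> a [^] i"
    using pow_absorb a b ge by simp
  also have "\<dots> = b [^] l' \<otimes> a [^] k'"
    using a b c by (simp add: m_assoc flip: nat_pow_mult)
  finally show ?thesis .
qed

text \<open>When \<open>x\<close> is put in front of a word containing \<open>x\<close>, the new
  letter becomes the first occurrence, and \<open>pow_absorb\<close> pulls the old block of
  \<open>x\<close> to it across the blocks in between. No other block changes.\<close>

lemma word_value_normal_form:
  assumes \<phi>: "\<phi> \<in> UNIV \<rightarrow> carrier G"
  shows "word_value G \<phi> w = word_value G (\<lambda>x. \<phi> x [^] count_list w x) (first_occs w)"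
proof (induction w)
  case Nil
  show ?case by (simp add: word_value_Nil)
next
  case (Cons x w)
  define \<psi> where "\<psi> = (\<lambda>y. \<phi> y [^] count_list w y)"
  define \<chi> where "\<chi> = (\<lambda>y. \<phi> y [^] count_list (x # w) y)"
  have x: "\<phi> x \<in> carrier G" using \<phi> by auto
  have \<psi>: "\<psi> \<in> UNIV \<rightarrow> carrier G" and \<chi>: "\<chi> \<in> UNIV \<rightarrow> carrier G"
    using \<phi> by (auto simp: \<psi>_def \<chi>_def Pi_iff)
  note closed = word_value_closed[OF monoid_axioms \<psi>]
  have eq: "word_value G \<chi> us = word_value G \<psi> us" if "x \<notin> set us" for us
    using that by (intro word_value_cong) (auto simp: \<psi>_def \<chi>_def)
  have "\<phi> x \<otimes> word_value G \<psi> (first_occs w) =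
      \<phi> x [^] Suc (count_list w x) \<otimes> word_value G \<psi> (removeAll x (first_occs w))"
  proof (cases "x \<in> set w")
    case False
    then show ?thesis using x by simp
  next
    case True
    then obtain p q where pq: "first_occs w = p @ x # q" by (metis set_first_occs split_list)
    then have nin: "x \<notin> set p" "x \<notin> set q"
      using distinct_first_occs[of w] by auto
    then have r: "removeAll x (first_occs w) = p @ q" using pq by simp
    \<comment> \<open>The exponent 1 displays the new letter as a power, so that
      \<open>pow_absorb\<close> applies.\<close>
    have "\<phi> x \<otimes> word_value G \<psi> (first_occs w) =
        (\<phi> x [^] (1::nat) \<otimes> word_value G \<psi> p \<otimes> \<phi> x [^] count_list w x) \<otimes> word_value G \<psi> q"
      using x closed
      by (simp add: pq word_value_append[OF monoid_axioms \<psi>] word_value_Cons \<psi>_def[THEN fun_cong, of x] m_assoc)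
    also have "\<dots> = \<phi> x [^] Suc (count_list w x) \<otimes> word_value G \<psi> (p @ q)"
      using x closed
      by (subst pow_absorb) (auto simp: word_value_append[OF monoid_axioms \<psi>] m_assoc simp del: nat_pow_Suc)
    finally show ?thesis using r by simp
  qed
  then have "word_value G \<phi> (x # w) = word_value G \<chi> (first_occs (x # w))"
    using Cons eq[of "removeAll x (first_occs w)"] unfolding \<psi>_def[symmetric]
    by (simp add: word_value_Cons \<chi>_def[THEN fun_cong, of x] del: nat_pow_Suc)
  then show ?case by (simp add: \<chi>_def)
qed

text \<open>Substituting the identity element for every letter but \<open>x\<close> leaves an
  equation between two powers of one element with different exponents.\<close>

lemma satisfies_imp_pow_id:
  assumes s: "satisfies_identity G (u, v)" and ne: "count_list u x \<noteq> count_list v x"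
  shows "satisfies_identity G (pow_id (min (count_list u x) (count_list v x)))"
  unfolding satisfies_pow_id
proof
  fix a assume a: "a \<in> carrier G"
  define \<phi> where "\<phi> = (\<lambda>y. if y = x then a else \<one>)"
  have \<phi>: "\<phi> \<in> UNIV \<rightarrow> carrier G" using a by (auto simp: \<phi>_def)
  have val: "word_value G \<phi> w = a [^] count_list w x" for w
  proof (induction w)
    case (Cons y w)
    then show ?case using a nat_pow_Suc2[of a "count_list w x"]
      by (auto simp: \<phi>_def word_value_Cons simp del: nat_pow_Suc)
  qed (simp add: word_value_Nil)
  have "a [^] count_list u x = a [^] count_list v x"
    using s \<phi> val by (auto simp: satisfies_identity_def)
  then show "a [^] min (count_list u x) (count_list v x) =
      a [^] Suc (min (count_list u x) (count_list v x))"
    using ne eq_pow_imp_stable[OF a, of "count_list u x" "count_list v x"]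
      eq_pow_imp_stable[OF a, of "count_list v x" "count_list u x"]
    by (cases "count_list u x < count_list v x") (simp_all add: min_def del: nat_pow_Suc)
qed

lemma word_value_pair:
  assumes ab: "a \<in> carrier G" "b \<in> carrier G" and "precedes (first_occs w) x y"
  shows "word_value G (\<lambda>z. if z = x then a else if z = y then b else \<one>) w =
    a [^] count_list w x \<otimes> b [^] count_list w y"
proof -
  define \<phi> where "\<phi> = (\<lambda>z. if z = x then a else if z = y then b else \<one>)"
  have \<phi>: "\<phi> \<in> UNIV \<rightarrow> carrier G" using ab by (auto simp: \<phi>_def)
  define \<psi> where "\<psi> = (\<lambda>z. \<phi> z [^] count_list w z)"
  have \<psi>: "\<psi> \<in> UNIV \<rightarrow> carrier G" using \<phi> by (auto simp: \<psi>_def Pi_iff)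
  obtain p q r where pqr: "first_occs w = p @ x # q @ y # r"
    using assms(3) unfolding precedes_def
    by (metis append.assoc append_Cons in_set_conv_decomp)
  then have d: "distinct (p @ x # q @ y # r)" by (metis distinct_first_occs)
  have one: "word_value G \<psi> us = \<one>" if "x \<notin> set us" "y \<notin> set us" for us
    using that by (intro word_value_one) (auto simp: \<psi>_def \<phi>_def)
  have "word_value G \<phi> w = word_value G \<psi> (first_occs w)"
    using word_value_normal_form[OF \<phi>] by (simp add: \<psi>_def)
  also have "\<dots> = \<psi> x \<otimes> \<psi> y"
    using d \<psi> one[of p] one[of q] one[of r]
    by (auto simp: pqr word_value_append[OF monoid_axioms \<psi>] word_value_Cons Pi_iff)
  also have "\<dots> = a [^] count_list w x \<otimes> b [^] count_list w y"
    using d by (auto simp: \<psi>_def \<phi>_def)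
  finally show ?thesis by (simp add: \<phi>_def)
qed

text \<open>Erasing all other letters leaves the blocks of \<open>x\<close> and \<open>y\<close> in
  opposite orders, with exponents counted in \<open>u\<close> on one side and in \<open>v\<close> on
  the other. If the two counts of a letter differ, its power with the exponent from \<open>u\<close>
  is stable and hence central.\<close>

lemma satisfies_imp_comm_id:
  assumes s: "satisfies_identity G (u, v)" and inv: "inverted u v x y"
  shows "satisfies_identity G (comm_id (count_list u x) (count_list u y))"
  unfolding satisfies_comm_id
proof (intro ballI)
  fix a b assume ab: "a \<in> carrier G" "b \<in> carrier G"
  have xy: "x \<noteq> y"
    using inv distinct_first_occs[of u] unfolding inverted_def precedes_def
    by (metis disjoint_iff distinct_append)
  define \<phi> where "\<phi> = (\<lambda>z. if z = x then a else if z = y then b else \<one>)"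
  \<comment> \<open>The tests are swapped so that \<open>word_value_pair\<close> fits
    \<open>v\<close>, where \<open>y\<close> comes first.\<close>
  have \<phi>': "\<phi> = (\<lambda>z. if z = y then b else if z = x then a else \<one>)"
    using xy by (auto simp: \<phi>_def)
  have \<phi>: "\<phi> \<in> UNIV \<rightarrow> carrier G" using ab by (auto simp: \<phi>_def)
  have eq: "a [^] count_list u x \<otimes> b [^] count_list u y = b [^] count_list v y \<otimes> a [^] count_list v x"
  proof -
    have "a [^] count_list u x \<otimes> b [^] count_list u y = word_value G \<phi> u"
      using inv ab by (simp add: \<phi>_def word_value_pair inverted_def)
    also have "\<dots> = word_value G \<phi> v"
      using s \<phi> by (simp add: satisfies_identity_def)
    also have "\<dots> = b [^] count_list v y \<otimes> a [^] count_list v x"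
      using inv ab by (simp add: \<phi>' word_value_pair inverted_def)
    finally show ?thesis .
  qed
  have st: "c [^] min (count_list u z) (count_list v z) = c [^] Suc (min (count_list u z) (count_list v z))"
    if "count_list u z \<noteq> count_list v z" "c \<in> carrier G" for z c
    using satisfies_imp_pow_id[OF s that(1)] that(2) by (simp add: satisfies_pow_id)
  consider "count_list u x \<noteq> count_list v x" | "count_list u y \<noteq> count_list v y"
    | "count_list u x = count_list v x" "count_list u y = count_list v y" by blast
  then show "a [^] count_list u x \<otimes> b [^] count_list u y = b [^] count_list u y \<otimes> a [^] count_list u x"
  proof cases
    case 1
    show ?thesis by (rule stable_pow_central[OF _ _ st[OF 1]]) (use ab in auto)
  next
    case 2
    show ?thesis by (rule sym, rule stable_pow_central[OF _ _ st[OF 2]]) (use ab in auto)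
  next
    case 3
    then show ?thesis using eq by simp
  qed
qed

text \<open>Converse to \<open>satisfies_imp_pow_id\<close> and
  \<open>satisfies_imp_comm_id\<close>: the power identities equalise the exponents of the two
  normal forms, and the commutation identities rearrange the blocks.\<close>

lemma satisfies_identityI:
  assumes pow: "\<And>x. count_list u x \<noteq> count_list v x \<Longrightarrow>
      satisfies_identity G (pow_id (min (count_list u x) (count_list v x)))"
    and comm: "\<And>x y. inverted u v x y \<Longrightarrow>
      satisfies_identity G (comm_id (count_list u x) (count_list u y))"
  shows "satisfies_identity G (u, v)"
  unfolding satisfies_identity_def
proof
  fix \<phi> :: "nat \<Rightarrow> 'a" assume \<phi>: "\<phi> \<in> UNIV \<rightarrow> carrier G"
  define \<psi> where "\<psi> = (\<lambda>x. \<phi> x [^] count_list u x)"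
  have \<psi>: "\<psi> \<in> UNIV \<rightarrow> carrier G" using \<phi> by (auto simp: \<psi>_def Pi_iff)
  have \<psi>v: "\<psi> = (\<lambda>x. \<phi> x [^] count_list v x)"
  proof
    fix x
    show "\<psi> x = \<phi> x [^] count_list v x"
    proof (cases "count_list u x = count_list v x")
      case False
      let ?k = "min (count_list u x) (count_list v x)"
      have x: "\<phi> x \<in> carrier G" using \<phi> by auto
      have "\<phi> x [^] ?k = \<phi> x [^] Suc ?k" using pow[OF False] x by (simp add: satisfies_pow_id)
      then show ?thesis
        using pow_stable_ge[OF x, of ?k] unfolding \<psi>_def by (metis min.cobounded1 min.cobounded2)
    qed (simp add: \<psi>_def)
  qed
  have "word_value G \<psi> (first_occs u) = word_value G \<psi> (first_occs v)"
  proof (cases "set u = set v")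
    case True
    show ?thesis
    proof (rule word_value_reorder[OF \<psi>])
      fix x y assume "precedes (first_occs u) x y" "precedes (first_occs v) y x"
      then have "satisfies_identity G (comm_id (count_list u x) (count_list u y))"
        by (intro comm) (simp add: inverted_def)
      then show "\<psi> x \<otimes> \<psi> y = \<psi> y \<otimes> \<psi> x"
        using \<phi> by (auto simp: satisfies_comm_id \<psi>_def Pi_iff)
    qed (use True in auto)
  next
    \<comment> \<open>A letter of only one word has minimum count 0, and \<open>pow_id 0\<close>
      says that every element is the identity element.\<close>
    case False
    then obtain x where "(x \<in> set u) \<noteq> (x \<in> set v)" by blast
    then have "(count_list u x = 0) \<noteq> (count_list v x = 0)" by (simp add: count_list_0_iff)
    then have "satisfies_identity G (pow_id 0)" using pow[of x] by (auto simp: min_def split: if_splits)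
    then have "word_value G \<psi> w = \<one>" for w
      using word_value_closed[OF monoid_axioms \<psi>, of w] by (auto simp: satisfies_pow_id)
    then show ?thesis by simp
  qed
  then show "word_value G \<phi> (fst (u, v)) = word_value G \<phi> (snd (u, v))"
    using word_value_normal_form[OF \<phi>] \<psi>v unfolding \<psi>_def by simp
qed

end

section \<open>The trace monoids as refuting monoids\<close>

text \<open>The image of the following map, with the multiplication induced by concatenation, is the
  monoid that refutes \<open>comm_id k l\<close>; for \<open>l = 0\<close> it refutes \<open>pow_id k\<close>.\<close>

definition trace :: "nat \<Rightarrow> nat \<Rightarrow> bool list \<Rightarrow> (nat \<times> nat \<times> bool) option" where
  "trace k l w =
     (if count_list w True \<le> k \<and> count_list w False \<le> l
      then Some (count_list w True, count_list w False, w \<noteq> [] \<and> hd w) else None)"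

text \<open>The third component of a trace is \<open>False\<close> for the empty word as well as for
  words starting with \<open>False\<close>; the counts separate these cases.\<close>

lemma Nil_iff_count_bool: "w = [] \<longleftrightarrow> count_list w True = 0 \<and> count_list w False = 0"
  by (cases w) auto

lemma trace_eq_None_iff: "trace k l w = None \<longleftrightarrow> k < count_list w True \<or> l < count_list w False"
  by (auto simp: trace_def)

lemma trace_eqI:
  assumes "\<And>b. count_list u b = count_list v b" "u \<noteq> [] \<Longrightarrow> hd u = hd v"
  shows "trace k l u = trace k l v"
proof -
  have "u = [] \<longleftrightarrow> v = []" by (simp only: Nil_iff_count_bool assms)
  then show ?thesis using assms by (auto simp: trace_def)
qed

lemma trace_eqD:
  assumes "trace k l u = trace k l v" "trace k l u \<noteq> None"
  shows "count_list u b = count_list v b" "u = [] \<longleftrightarrow> v = []" "u \<noteq> [] \<Longrightarrow> hd u = hd v"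
proof -
  have "\<not> (k < count_list u True \<or> l < count_list u False)"
    "\<not> (k < count_list v True \<or> l < count_list v False)"
    using assms by (simp_all flip: trace_eq_None_iff)
  then have eq: "count_list u True = count_list v True" "count_list u False = count_list v False"
    "(u \<noteq> [] \<and> hd u) = (v \<noteq> [] \<and> hd v)"
    using assms(1) by (simp_all add: trace_def not_less)
  show "count_list u b = count_list v b" using eq by (cases b) simp_all
  show nil: "u = [] \<longleftrightarrow> v = []" by (simp only: Nil_iff_count_bool eq)
  show "u \<noteq> [] \<Longrightarrow> hd u = hd v" using eq(3) nil by simp
qed

text \<open>Too many letters in a factor are too many in the product. Otherwise counts add up, and
  the first letter comes from the left factor unless that is empty. So the kernel of
  \<open>trace\<close> is a congruence.\<close>

lemma trace_append:
  assumes u: "trace k l u = trace k l u'" and v: "trace k l v = trace k l v'"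
  shows "trace k l (u @ v) = trace k l (u' @ v')"
proof (cases "trace k l u = None \<or> trace k l v = None")
  case True
  then have "trace k l u' = None \<or> trace k l v' = None" using assms by simp
  then have "trace k l (u @ v) = None" "trace k l (u' @ v') = None"
    using True unfolding trace_eq_None_iff count_list_append by linarith+
  then show ?thesis by simp
next
  case False
  then have *: "trace k l u \<noteq> None" "trace k l v \<noteq> None" by auto
  show ?thesis
    using trace_eqD(1)[OF u *(1)] trace_eqD(1)[OF v *(2)] trace_eqD(2)[OF u *(1)]
      trace_eqD(3)[OF u *(1)] trace_eqD(3)[OF v *(2)]
    by (intro trace_eqI) (simp_all add: hd_append)
qed

text \<open>The quotient of the free monoid on two letters by the kernel of \<open>trace\<close>,
  with \<open>None\<close> as zero if it is attained. Products are taken of chosen representatives;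
  by \<open>trace_append\<close> the choice does not matter.\<close>

definition trace_monoid :: "nat \<Rightarrow> nat \<Rightarrow> (nat \<times> nat \<times> bool) option monoid" where
  "trace_monoid k l = \<lparr>carrier = range (trace k l),
     mult = (\<lambda>s t. trace k l (inv_into UNIV (trace k l) s @ inv_into UNIV (trace k l) t)), one = trace k l []\<rparr>"

lemma trace_inv: "s \<in> range (trace k l) \<Longrightarrow> trace k l (inv_into UNIV (trace k l) s) = s"
  by (rule f_inv_into_f)

lemma trace_mult: "trace k l u \<otimes>\<^bsub>trace_monoid k l\<^esub> trace k l v = trace k l (u @ v)"
  unfolding trace_monoid_def monoid.simps by (rule trace_append) (simp_all add: trace_inv)

lemma trace_monoid_simps:
  "carrier (trace_monoid k l) = range (trace k l)" "\<one>\<^bsub>trace_monoid k l\<^esub> = trace k l []"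
  by (simp_all add: trace_monoid_def)

lemma monoid_trace_monoid: "monoid (trace_monoid k l)"
  by (rule monoidI) (auto simp: trace_monoid_simps trace_mult)

lemma word_value_trace_monoid:
  "word_value (trace_monoid k l) (\<lambda>x. trace k l (\<theta> x)) w = trace k l (concat (map \<theta> w))"
  by (induction w) (simp_all add: word_value_Nil word_value_Cons trace_mult trace_monoid_simps)

text \<open>Every element is the trace of a word, so assignments lift to substitutions
  \<open>\<theta>\<close> of words for letters.\<close>

lemma satisfies_trace_monoid:
  "satisfies_identity (trace_monoid k l) (u, v) \<longleftrightarrow>
     (\<forall>\<theta>. trace k l (concat (map \<theta> u)) = trace k l (concat (map \<theta> v)))"
proof
  assume s: "satisfies_identity (trace_monoid k l) (u, v)"
  show "\<forall>\<theta>. trace k l (concat (map \<theta> u)) = trace k l (concat (map \<theta> v))"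
  proof
    fix \<theta> :: "nat \<Rightarrow> bool list"
    have "(\<lambda>x. trace k l (\<theta> x)) \<in> UNIV \<rightarrow> carrier (trace_monoid k l)"
      by (simp add: trace_monoid_simps)
    then show "trace k l (concat (map \<theta> u)) = trace k l (concat (map \<theta> v))"
      using s by (auto simp: satisfies_identity_def simp flip: word_value_trace_monoid)
  qed
next
  assume r: "\<forall>\<theta>. trace k l (concat (map \<theta> u)) = trace k l (concat (map \<theta> v))"
  show "satisfies_identity (trace_monoid k l) (u, v)"
    unfolding satisfies_identity_def
  proof
    fix \<phi> :: "nat \<Rightarrow> (nat \<times> nat \<times> bool) option"
    assume "\<phi> \<in> UNIV \<rightarrow> carrier (trace_monoid k l)"
    then have "\<phi> x \<in> range (trace k l)" for x
      by (auto simp: trace_monoid_simps Pi_iff)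
    then have "\<phi> = (\<lambda>x. trace k l (inv_into UNIV (trace k l) (\<phi> x)))"
      by (simp add: trace_inv)
    then show "word_value (trace_monoid k l) \<phi> (fst (u, v)) = word_value (trace_monoid k l) \<phi> (snd (u, v))"
      using r word_value_trace_monoid[of k l "\<lambda>x. inv_into UNIV (trace k l) (\<phi> x)"] by simp
  qed
qed

text \<open>With \<open>True\<close> for the letter, the word of length \<open>Suc k\<close> is
  already zero and that of length \<open>k\<close> is not.\<close>

lemma not_satisfies_pow_id: "\<not> satisfies_identity (trace_monoid k 0) (pow_id k)"
proof -
  have "concat (map (\<lambda>_. [True]) (replicate m x)) = replicate m True" for m and x :: nat
    by (induction m) auto
  moreover have "count_list (replicate m True) b = (if b then m else 0)" for m b
    by (induction m) auto
  ultimately show ?thesis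
    unfolding pow_id_def satisfies_trace_monoid
    by (auto intro!: exI[of _ "\<lambda>_. [True]"] simp: trace_def simp del: replicate_Suc)
qed

text \<open>With \<open>True\<close> and \<open>False\<close> for the letters, both sides are just
  short enough to avoid zero and are told apart by their first letters; these differ because both
  exponents are positive.\<close>

lemma not_satisfies_comm_id:
  assumes "k \<ge> 1" "l \<ge> 1"
  shows "\<not> satisfies_identity (trace_monoid k l) (comm_id k l)"
proof -
  have c: "concat (map (\<lambda>x::nat. [x = 0]) (replicate m x)) = replicate m (x = 0)" for m x
    by (induction m) auto
  moreover have "count_list (replicate m a) b = (if a = b then m else 0)" for m and a b :: bool
    by (induction m) auto
  ultimately show ?thesis
    using assms unfolding comm_id_def satisfies_trace_monoid
    by (auto intro!: exI[of _ "\<lambda>x. [x = 0]"] simp: trace_def hd_append)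
qed

text \<open>A repeated occurrence cannot supply the head: either its image is empty, or an earlier
  occurrence has supplied a letter already.\<close>

lemma concat_map_first_occs_hd:
  "hd (concat (map \<theta> w)) = hd (concat (map \<theta> (first_occs w)))"
proof (induction w)
  case (Cons x w)
  have "concat (map \<theta> (removeAll x us)) = concat (map \<theta> us)" if "\<theta> x = []" for us
    using that by (induction us) auto
  then show ?case using Cons by (cases "\<theta> x = []") auto
qed simp

text \<open>If a letter with different counts is not erased, its many copies turn both sides into
  zero. Otherwise the counts of both sides agree, and differing first letters of a nonzero instance
  would come from an inverted pair with counts too small for \<open>inv\<close>. Both orders of
  \<open>k\<close> and \<open>l\<close> appear because either image may be the one starting with
  \<open>True\<close>.\<close>

lemma satisfies_trace_monoidI:
  assumes cnt: "\<And>x. count_list u x \<noteq> count_list v x \<Longrightarrow>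
      max k l < min (count_list u x) (count_list v x)"
    and inv: "\<And>x y. inverted u v x y \<Longrightarrow>
      \<not> (count_list u x \<le> k \<and> count_list u y \<le> l) \<and> \<not> (count_list u x \<le> l \<and> count_list u y \<le> k)"
  shows "satisfies_identity (trace_monoid k l) (u, v)"
  unfolding satisfies_trace_monoid
proof
  fix \<theta> :: "nat \<Rightarrow> bool list"
  let ?u = "concat (map \<theta> u)" and ?v = "concat (map \<theta> v)"
  have set: "set u = set v"
  proof (rule Set.set_eqI)
    fix x
    have "count_list u x = 0 \<longleftrightarrow> count_list v x = 0"
      using cnt[of x] by (cases "count_list u x = count_list v x") simp_all
    then show "x \<in> set u \<longleftrightarrow> x \<in> set v" by (simp add: count_list_0_iff)
  qed
  have ge: "count_list w x \<le> count_list (concat (map \<theta> w)) b" if "b \<in> set (\<theta> x)" for w x b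
  proof (induction w)
    case (Cons y w)
    moreover have "count_list (\<theta> x) b \<noteq> 0" using that by (simp add: count_list_0_iff)
    ultimately show ?case by auto
  qed simp
  have cnt_sum: "count_list (concat (map \<theta> w)) b = (\<Sum>x\<in>set w. count_list w x * count_list (\<theta> x) b)" for w b
    by (simp add: count_list_concat comp_def sum_list_map_eq_sum_count)
  show "trace k l ?u = trace k l ?v"
  proof (cases "\<exists>x. count_list u x \<noteq> count_list v x \<and> \<theta> x \<noteq> []")
    case True
    then obtain x where x: "count_list u x \<noteq> count_list v x" "hd (\<theta> x) \<in> set (\<theta> x)" by auto
    \<comment> \<open>The head of the image occurs more than \<open>max k l\<close> times on both
      sides, so it exceeds its bound whichever truth value it is.\<close>
    have "trace k l ?u = None \<and> trace k l ?v = None"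
      using cnt[OF x(1)] ge[OF x(2), of u] ge[OF x(2), of v] unfolding trace_eq_None_iff
      by (cases "hd (\<theta> x)") auto
    then show ?thesis by simp
  next
    case False
    have "count_list u x * count_list (\<theta> x) b = count_list v x * count_list (\<theta> x) b" for x b
      using False by (cases "\<theta> x = []") auto
    then have eq: "count_list ?u b = count_list ?v b" for b
      unfolding cnt_sum set by (intro sum.cong) auto
    have "hd ?u = hd ?v" if small: "count_list ?u True \<le> k" "count_list ?u False \<le> l" and ne: "?u \<noteq> []"
    proof -
      \<comment> \<open>The head of a nonempty instance comes from the first letter of
        \<open>first_occs w\<close> that is not erased.\<close>
      have first: "\<exists>p x q. first_occs w = p @ x # q \<and> (\<forall>y\<in>set p. \<theta> y = []) \<and> \<theta> x \<noteq> [] \<and>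
          hd (concat (map \<theta> w)) = hd (\<theta> x)" if "concat (map \<theta> w) \<noteq> []" for w
      proof -
        have "\<exists>x\<in>set (first_occs w). \<theta> x \<noteq> []" using that by simp
        then obtain p x q where pq: "first_occs w = p @ x # q" "\<theta> x \<noteq> []" "\<forall>y\<in>set p. \<not> \<theta> y \<noteq> []"
          using split_list_first_prop[of "first_occs w" "\<lambda>x. \<theta> x \<noteq> []"] by blast
        have "concat (map \<theta> p) = []" using pq(3) by simp
        then show ?thesis
          using pq concat_map_first_occs_hd[of \<theta> w] by (auto simp: hd_append)
      qed
      have "?v \<noteq> []" using ne set by auto
      then obtain p x q p' y q' where
        u: "first_occs u = p @ x # q" "\<forall>z\<in>set p. \<theta> z = []" "\<theta> x \<noteq> []" "hd ?u = hd (\<theta> x)" and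
        v: "first_occs v = p' @ y # q'" "\<forall>z\<in>set p'. \<theta> z = []" "\<theta> y \<noteq> []" "hd ?v = hd (\<theta> y)"
        using first[OF ne] first[of v] by metis
      show ?thesis
      proof (cases "x = y")
        case True
        then show ?thesis using u v by simp
      next
        case False
        have "y \<in> set (first_occs u)" "x \<in> set (first_occs v)"
          using set set_first_occs[of u] set_first_occs[of v] unfolding u v by auto
        \<comment> \<open>All letters before \<open>x\<close> in \<open>first_occs u\<close> are
          erased but \<open>y\<close> is not, so \<open>y\<close> comes after \<open>x\<close>;
          likewise with the roles exchanged.\<close>
        then have "y \<in> set q" "x \<in> set q'" using u v False by auto
        then have xy: "inverted u v x y"
          using u(1) v(1) precedes_appendI[of x "p @ [x]" y q] precedes_appendI[of y "p' @ [y]" x q']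
          by (simp add: inverted_def)
        have le: "count_list u z \<le> count_list ?u (hd (\<theta> z))" if "\<theta> z \<noteq> []" for z
          using that by (intro ge) simp
        show ?thesis
        proof (rule ccontr)
          assume "hd ?u \<noteq> hd ?v"
          \<comment> \<open>The heads are opposite truth values, so one of the counts of
            \<open>x\<close> and \<open>y\<close> is bounded by \<open>k\<close> and the other by
            \<open>l\<close>, against \<open>inv\<close>.\<close>
          then have "hd (\<theta> y) \<longleftrightarrow> \<not> hd (\<theta> x)" using u(4) v(4) by auto
          then show False
            using inv[OF xy] small le[OF u(3)] le[OF v(3)]
            by (cases "hd (\<theta> x)") auto
        qed
      qed
    qed
    then have "trace k l ?u = trace k l ?v" if "trace k l ?u \<noteq> None"
      using that eq unfolding trace_eq_None_iff by (intro trace_eqI) auto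
    moreover have "trace k l ?u = None \<longleftrightarrow> trace k l ?v = None"
      unfolding trace_eq_None_iff eq ..
    ultimately show ?thesis by auto
  qed
qed

section \<open>Equational theories, primality of the basic identities, and the distributive
  inclusion\<close>

definition class_identities :: "'a monoid set \<Rightarrow> monoid_identity set" where
  "class_identities V = {e. \<forall>M\<in>V. satisfies_identity M e}"

lemma monoid_var_class_identities:
  assumes "monoid_variety V"
  shows "monoid_var (class_identities V) = V"
  using assms by (fastforce simp: monoid_variety_def monoid_var_def class_identities_def)

text \<open>As \<open>j\<close> is at most \<open>k\<close> or at most \<open>l\<close>, one of the
  two powers is stable and hence central.\<close>

lemma stable_imp_satisfies_comm_id:
  assumes "P_monoid M n" "satisfies_identity M (pow_id j)" "j \<le> max k l"
  shows "satisfies_identity M (comm_id k l)"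
proof -
  interpret P_monoid M n by fact
  show ?thesis
    using assms(2,3) stable_pow_central[of _ _ j k] stable_pow_central[of _ _ j l]
    unfolding satisfies_comm_id satisfies_pow_id le_max_iff_disj
    by (metis nat_pow_closed)
qed

lemma pow_id_mono:
  assumes "monoid M" "satisfies_identity M (pow_id j)" "j \<le> k"
  shows "satisfies_identity M (pow_id k)"
proof -
  interpret monoid M by fact
  show ?thesis
    using assms(2,3) pow_stable_ge[of _ j k] pow_stable_ge[of _ j "Suc k"]
    by (auto simp: satisfies_pow_id simp del: nat_pow_Suc)
qed

lemma comm_id_mono:
  assumes "P_monoid M n" "satisfies_identity M (comm_id k l)"
    "1 \<le> k" "1 \<le> l" "k \<le> k'" "l \<le> l'"
  shows "satisfies_identity M (comm_id k' l')"
proof -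
  interpret P_monoid M n by fact
  show ?thesis
    unfolding satisfies_comm_id
  proof (intro ballI)
    fix a b assume ab: "a \<in> carrier M" "b \<in> carrier M"
    then have "a [^]\<^bsub>M\<^esub> k \<otimes>\<^bsub>M\<^esub> b [^]\<^bsub>M\<^esub> l = b [^]\<^bsub>M\<^esub> l \<otimes>\<^bsub>M\<^esub> a [^]\<^bsub>M\<^esub> k"
      using assms(2) by (simp only: satisfies_comm_id)
    then show "a [^]\<^bsub>M\<^esub> k' \<otimes>\<^bsub>M\<^esub> b [^]\<^bsub>M\<^esub> l' = b [^]\<^bsub>M\<^esub> l' \<otimes>\<^bsub>M\<^esub> a [^]\<^bsub>M\<^esub> k'"
      by (rule comm_pow_mono[OF ab assms(3-6)])
  qed
qed

lemma comm_id_sym: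
  assumes "monoid M" "satisfies_identity M (comm_id k l)"
  shows "satisfies_identity M (comm_id l k)"
  using assms(2) unfolding monoid.satisfies_comm_id[OF assms(1)] by metis

text \<open>A monoid of \<open>V\<close> refuting \<open>pow_id k\<close> refutes every
  \<open>pow_id j\<close> with \<open>j\<close> at most \<open>k\<close>, so counts in an identity
  of \<open>V\<close> differ only above \<open>k\<close>. With \<open>l\<close> = 0 the order
  condition is settled, since both letters of an inverted pair occur in \<open>u\<close>.\<close>

lemma trace_monoid_satisfies_of_not_pow_id:
  assumes V: "V \<subseteq> P_variety n" and e: "e \<in> class_identities V"
    and "pow_id k \<notin> class_identities V"
  shows "satisfies_identity (trace_monoid k 0) e"
proof -
  obtain u v where [simp]: "e = (u, v)" by (cases e)
  obtain M where M: "M \<in> V" "\<not> satisfies_identity M (pow_id k)"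
    using assms by (auto simp: class_identities_def)
  interpret P_monoid M n using M V by (intro P_monoidI) auto
  have s: "satisfies_identity M (u, v)" using e M by (auto simp: class_identities_def)
  have "satisfies_identity (trace_monoid k 0) (u, v)"
  proof (rule satisfies_trace_monoidI)
    fix x assume "count_list u x \<noteq> count_list v x"
    then have "satisfies_identity M (pow_id (min (count_list u x) (count_list v x)))"
      by (rule satisfies_imp_pow_id[OF s])
    then show "max k 0 < min (count_list u x) (count_list v x)"
      using pow_id_mono[OF monoid_axioms] M(2) by (metis max_0R not_le)
  next
    fix x y assume "inverted u v x y"
    then have "1 \<le> count_list u x" "1 \<le> count_list u y"
      by (rule inverted_count_ge)+
    then show "\<not> (count_list u x \<le> k \<and> count_list u y \<le> 0) \<and> \<not> (count_list u x \<le> 0 \<and> count_list u y \<le> k)"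
      by linarith
  qed
  then show ?thesis by simp
qed

text \<open>A monoid refuting \<open>comm_id k l\<close> also refutes \<open>pow_id j\<close> for
  \<open>j\<close> up to \<open>max k l\<close>, and \<open>comm_id\<close> with smaller positive
  exponents in either order. These are the two conditions of
  \<open>satisfies_trace_monoidI\<close>.\<close>

lemma trace_monoid_satisfies_of_not_comm_id:
  assumes V: "V \<subseteq> P_variety n" and e: "e \<in> class_identities V"
    and "comm_id k l \<notin> class_identities V"
  shows "satisfies_identity (trace_monoid k l) e"
proof -
  obtain u v where [simp]: "e = (u, v)" by (cases e)
  obtain M where M: "M \<in> V" "\<not> satisfies_identity M (comm_id k l)"
    using assms by (auto simp: class_identities_def)
  have P: "P_monoid M n" using M V by (intro P_monoidI) auto
  interpret P_monoid M n by (rule P)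
  have s: "satisfies_identity M (u, v)" using e M by (auto simp: class_identities_def)
  have "satisfies_identity (trace_monoid k l) (u, v)"
  proof (rule satisfies_trace_monoidI)
    fix x assume "count_list u x \<noteq> count_list v x"
    then have "satisfies_identity M (pow_id (min (count_list u x) (count_list v x)))"
      by (rule satisfies_imp_pow_id[OF s])
    then show "max k l < min (count_list u x) (count_list v x)"
      using stable_imp_satisfies_comm_id[OF P] M(2) by (metis not_le)
  next
    fix x y assume inv: "inverted u v x y"
    then have ge: "1 \<le> count_list u x" "1 \<le> count_list u y"
      by (rule inverted_count_ge)+
    have c: "satisfies_identity M (comm_id (count_list u x) (count_list u y))"
      by (rule satisfies_imp_comm_id[OF s inv])
    show "\<not> (count_list u x \<le> k \<and> count_list u y \<le> l) \<and> \<not> (count_list u x \<le> l \<and> count_list u y \<le> k)"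
      using comm_id_mono[OF P c ge] comm_id_mono[OF P comm_id_sym[OF monoid_axioms c] ge(2,1)] M(2)
      by blast
  qed
  then show ?thesis by simp
qed

text \<open>The union of the two theories defines the intersection. As \<open>N\<close> lives in
  another type, \<open>var_subset_transfer\<close> carries the consequences of that union over to
  it.\<close>

lemma satisfies_of_inter:
  fixes V W :: "'a monoid set" and N :: "'b monoid"
  assumes inf: "infinite (UNIV :: 'a set)" and VW: "monoid_variety V" "monoid_variety W"
    and N: "monoid N" "\<And>e. e \<in> class_identities V \<union> class_identities W \<Longrightarrow> satisfies_identity N e"
    and e: "e \<in> class_identities (V \<inter> W)"
  shows "satisfies_identity N e"
proof -
  let ?\<Sigma> = "class_identities V \<union> class_identities W"
  have "(monoid_var ?\<Sigma> :: 'a monoid set) =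
      monoid_var (class_identities V) \<inter> monoid_var (class_identities W)"
    by (auto simp: monoid_var_def)
  also have "\<dots> = V \<inter> W"
    using monoid_var_class_identities VW by metis
  also have "V \<inter> W \<subseteq> monoid_var {e}"
    using e VW by (auto simp: monoid_var_def class_identities_def monoid_variety_def)
  finally have "(monoid_var ?\<Sigma> :: 'a monoid set) \<subseteq> monoid_var {e}" .
  from var_subset_transfer[OF inf this] show ?thesis
    using N by (fastforce simp: monoid_var_def)
qed

text \<open>Otherwise the trace monoid would satisfy both theories, hence every identity of the
  intersection, among them the one it refutes.\<close>

lemma pow_id_prime:
  fixes V W :: "'a monoid set"
  assumes inf: "infinite (UNIV :: 'a set)" and VW: "monoid_variety V" "monoid_variety W"
    and sub: "V \<subseteq> P_variety n" "W \<subseteq> P_variety n"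
    and e: "pow_id k \<in> class_identities (V \<inter> W)"
  shows "pow_id k \<in> class_identities V \<union> class_identities W"
proof (rule ccontr)
  assume "pow_id k \<notin> class_identities V \<union> class_identities W"
  then have "satisfies_identity (trace_monoid k 0) (pow_id k)"
    using trace_monoid_satisfies_of_not_pow_id sub
    by (intro satisfies_of_inter[OF inf VW monoid_trace_monoid _ e]) blast
  then show False using not_satisfies_pow_id by blast
qed

lemma comm_id_prime:
  fixes V W :: "'a monoid set"
  assumes inf: "infinite (UNIV :: 'a set)" and VW: "monoid_variety V" "monoid_variety W"
    and sub: "V \<subseteq> P_variety n" "W \<subseteq> P_variety n" and ge: "k \<ge> 1" "l \<ge> 1"
    and e: "comm_id k l \<in> class_identities (V \<inter> W)"
  shows "comm_id k l \<in> class_identities V \<union> class_identities W"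
proof (rule ccontr)
  assume "comm_id k l \<notin> class_identities V \<union> class_identities W"
  then have "satisfies_identity (trace_monoid k l) (comm_id k l)"
    using trace_monoid_satisfies_of_not_comm_id sub
    by (intro satisfies_of_inter[OF inf VW monoid_trace_monoid _ e]) blast
  then show False using not_satisfies_comm_id ge by blast
qed

text \<open>An identity of both \<open>X \<inter> Y\<close> and \<open>X \<inter> Z\<close> reduces
  to basic ones valid in both. By primality each of these holds in \<open>X\<close> or
  \<open>Y\<close>, and in \<open>X\<close> or \<open>Z\<close>.\<close>

lemma variety_distrib:
  fixes X Y Z :: "'a monoid set"
  assumes inf: "infinite (UNIV :: 'a set)"
    and var: "monoid_variety X" "monoid_variety Y" "monoid_variety Z"
    and sub: "X \<subseteq> P_variety n" "Y \<subseteq> P_variety n" "Z \<subseteq> P_variety n"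
  shows "X \<inter> monoid_var (class_identities (Y \<union> Z)) \<subseteq>
    monoid_var (class_identities (X \<inter> Y \<union> X \<inter> Z))"
proof
  fix M assume M: "M \<in> X \<inter> monoid_var (class_identities (Y \<union> Z))"
  interpret P_monoid M n using M sub by (intro P_monoidI) auto
  \<comment> \<open>An identity that fails in \<open>X\<close> is then one of both \<open>Y\<close>
    and \<open>Z\<close>, hence of their join.\<close>
  have basic: "satisfies_identity M b"
    if "b \<in> class_identities X \<union> class_identities Y" "b \<in> class_identities X \<union> class_identities Z" for b
  proof (cases "b \<in> class_identities X")
    case True
    then show ?thesis using M by (auto simp: class_identities_def)
  next
    case False
    then have "b \<in> class_identities (Y \<union> Z)" using that by (auto simp: class_identities_def)
    then show ?thesis using M by (auto simp: monoid_var_def)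
  qed
  have "satisfies_identity M (u, v)" if e: "(u, v) \<in> class_identities (X \<inter> Y \<union> X \<inter> Z)" for u v
  proof (rule satisfies_identityI)
    have PM: "P_monoid N n" "satisfies_identity N (u, v)" if "N \<in> X \<inter> Y \<or> N \<in> X \<inter> Z" for N
      using that e sub by (auto simp: class_identities_def intro!: P_monoidI)
    fix x
    {
      assume "count_list u x \<noteq> count_list v x"
      then have "pow_id (min (count_list u x) (count_list v x)) \<in> class_identities (X \<inter> Y)"
        "pow_id (min (count_list u x) (count_list v x)) \<in> class_identities (X \<inter> Z)"
        using PM by (auto simp: class_identities_def intro!: P_monoid.satisfies_imp_pow_id)
      then show "satisfies_identity M (pow_id (min (count_list u x) (count_list v x)))"
        by (intro basic) (rule pow_id_prime[OF inf]; use var sub in blast)+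
    }
    {
      fix y assume inv: "inverted u v x y"
      then have ge: "1 \<le> count_list u x" "1 \<le> count_list u y"
        by (rule inverted_count_ge)+
      have "comm_id (count_list u x) (count_list u y) \<in> class_identities (X \<inter> Y)"
        "comm_id (count_list u x) (count_list u y) \<in> class_identities (X \<inter> Z)"
        using PM inv by (auto simp: class_identities_def intro!: P_monoid.satisfies_imp_comm_id)
      then show "satisfies_identity M (comm_id (count_list u x) (count_list u y))"
        by (intro basic) (rule comm_id_prime[OF inf]; use var sub ge in blast)+
    }
  qed
  then show "M \<in> monoid_var (class_identities (X \<inter> Y \<union> X \<inter> Z))"
    using monoid_axioms by (auto simp: monoid_var_def)
qed

section \<open>Meets and joins in the subvariety lattice\<close>

lemma monoid_variety_Int:
  assumes "monoid_variety V" "monoid_variety W"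
  shows "monoid_variety (V \<inter> W)"
proof -
  obtain \<Sigma> \<Sigma>' where "V = monoid_var \<Sigma>" "W = monoid_var \<Sigma>'"
    using assms by (auto simp: monoid_variety_def)
  then have "V \<inter> W = monoid_var (\<Sigma> \<union> \<Sigma>')" by (auto simp: monoid_var_def)
  then show ?thesis by (auto simp: monoid_variety_def)
qed

lemma monoid_var_class_identities_least:
  fixes V W :: "'a monoid set"
  assumes "monoid_variety V" "W \<subseteq> V"
  shows "monoid_var (class_identities W) \<subseteq> V"
proof -
  have "class_identities V \<subseteq> class_identities W"
    using assms(2) by (auto simp: class_identities_def)
  then have "monoid_var (class_identities W) \<subseteq> (monoid_var (class_identities V) :: 'a monoid set)"
    by (auto simp: monoid_var_def)
  then show ?thesis using monoid_var_class_identities[OF assms(1)] by simp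
qed

lemma subset_monoid_var_class_identities:
  assumes "monoid_variety V" "W \<subseteq> V"
  shows "W \<subseteq> monoid_var (class_identities W)"
  using assms by (auto simp: monoid_var_def class_identities_def monoid_variety_def)

context
  fixes V :: "'a monoid set"
  assumes V: "monoid_variety V"
begin

lemma subvariety_greatest_Lower:
  assumes "X \<in> carrier (subvariety_lattice V)" "Y \<in> carrier (subvariety_lattice V)"
  shows "greatest (subvariety_lattice V) (X \<inter> Y) (Lower (subvariety_lattice V) {X, Y})"
  using assms monoid_variety_Int
  by (fastforce simp: greatest_def Lower_def subvariety_lattice_def)

text \<open>A union of varieties need not be a variety, so the join is the variety generated by the
  union: all models of the common identities.\<close>

lemma subvariety_least_Upper:
  assumes "X \<in> carrier (subvariety_lattice V)" "Y \<in> carrier (subvariety_lattice V)"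
  shows "least (subvariety_lattice V) (monoid_var (class_identities (X \<union> Y)))
    (Upper (subvariety_lattice V) {X, Y})"
proof -
  have sub: "X \<union> Y \<subseteq> V" using assms by (auto simp: subvariety_lattice_def)
  have "monoid_variety (monoid_var (class_identities (X \<union> Y)) :: 'a monoid set)"
    by (auto simp: monoid_variety_def)
  then show ?thesis
    using assms sub monoid_var_class_identities_least[OF V sub]
      subset_monoid_var_class_identities[OF V sub] monoid_var_class_identities_least[of _ "X \<union> Y"]
    by (auto simp: least_def Upper_def subvariety_lattice_def)
qed

lemma lattice_subvariety_lattice: "lattice (subvariety_lattice V)"
proof -
  interpret partial_order "subvariety_lattice V"
    by unfold_locales (auto simp: subvariety_lattice_def)
  show ?thesis
    by unfold_locales (use subvariety_greatest_Lower subvariety_least_Upper in blast)+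
qed

lemma subvariety_meet:
  assumes "X \<in> carrier (subvariety_lattice V)" "Y \<in> carrier (subvariety_lattice V)"
  shows "X \<sqinter>\<^bsub>subvariety_lattice V\<^esub> Y = X \<inter> Y"
proof -
  interpret lattice "subvariety_lattice V" by (rule lattice_subvariety_lattice)
  show ?thesis
    unfolding meet_def inf_def using subvariety_greatest_Lower[OF assms]
    by (intro some_equality greatest_unique)
qed

lemma subvariety_join:
  assumes "X \<in> carrier (subvariety_lattice V)" "Y \<in> carrier (subvariety_lattice V)"
  shows "X \<squnion>\<^bsub>subvariety_lattice V\<^esub> Y = monoid_var (class_identities (X \<union> Y))"
proof -
  interpret lattice "subvariety_lattice V" by (rule lattice_subvariety_lattice)
  show ?thesis
    unfolding join_def sup_def using subvariety_least_Upper[OF assms]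
    by (intro some_equality least_unique)
qed

end

theorem corollary5p8:
  fixes n :: nat
  assumes "n \<ge> 1" and "infinite (UNIV :: 'a set)"
  shows "distributive_lattice (subvariety_lattice (P_variety n :: 'a monoid set))"
proof -
  let ?P = "P_variety n :: 'a monoid set"
  let ?L = "subvariety_lattice ?P"
  have P: "monoid_variety ?P" by (auto simp: monoid_variety_def P_variety_def)
  interpret lattice ?L by (rule lattice_subvariety_lattice[OF P])
  show ?thesis
  proof
    fix X Y Z assume car: "X \<in> carrier ?L" "Y \<in> carrier ?L" "Z \<in> carrier ?L"
    then have sub: "monoid_variety X" "monoid_variety Y" "monoid_variety Z"
      "X \<subseteq> ?P" "Y \<subseteq> ?P" "Z \<subseteq> ?P"
      by (auto simp: subvariety_lattice_def)
    have "X \<inter> monoid_var (class_identities (Y \<union> Z)) =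
        monoid_var (class_identities (X \<inter> Y \<union> X \<inter> Z))"
    proof
      show "X \<inter> monoid_var (class_identities (Y \<union> Z)) \<subseteq>
          monoid_var (class_identities (X \<inter> Y \<union> X \<inter> Z))"
        by (rule variety_distrib[OF assms(2) sub])
      \<comment> \<open>This reverse inclusion holds in every lattice.\<close>
      have "monoid_var (class_identities (X \<inter> Y \<union> X \<inter> Z)) \<subseteq> X"
        by (rule monoid_var_class_identities_least[OF sub(1)]) auto
      moreover have "monoid_var (class_identities (X \<inter> Y \<union> X \<inter> Z)) \<subseteq>
          (monoid_var (class_identities (Y \<union> Z)) :: 'a monoid set)"
        by (auto simp: monoid_var_def class_identities_def)
      ultimately show "monoid_var (class_identities (X \<inter> Y \<union> X \<inter> Z)) \<subseteq>
          X \<inter> monoid_var (class_identities (Y \<union> Z))" by blast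
    qed
    moreover have "X \<inter> Y \<in> carrier ?L" "X \<inter> Z \<in> carrier ?L"
      "monoid_var (class_identities (Y \<union> Z)) \<in> carrier ?L"
      using car subvariety_meet[OF P] subvariety_join[OF P] meet_closed join_closed by metis+
    ultimately show "X \<sqinter>\<^bsub>?L\<^esub> (Y \<squnion>\<^bsub>?L\<^esub> Z) = (X \<sqinter>\<^bsub>?L\<^esub> Y) \<squnion>\<^bsub>?L\<^esub> (X \<sqinter>\<^bsub>?L\<^esub> Z)"
      using car by (simp add: subvariety_meet[OF P] subvariety_join[OF P])
  qed
qed

end
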